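(* For every non-negative integer $n$ and every integer $i\ge 1$, $$f(n,i) = f(|n-2^{i-1}|,\, i-1) + f(n,\, i-1),$$ and moreover $f(0,i)=1$ for all $i \ge 0$.
   Context: For an integer $n$ and an integer $i\ge 0$, $f(n,i)$ denotes the number of binary signed-digit (BSD) representations of $n$ on $i$ bits, i.e. the number of tuples $(b_{i-1},\dots,b_0)\in\{1,0,-1\}^i$ with $n=\sum_{j=0}^{i-1} b_j 2^j$ (for $i=0$ the only tuple is the empty one, representing $0$). *)

theory Defs
  imports Main
begin

(* A tuple (b_{i-1}, ..., b_0) is a list with the least significant digit first,
   so that bs ! j is b_j. *)
definition bsd_reps :: "int \<Rightarrow> nat \<Rightarrow> int list set" where
  "bsd_reps n i = {bs. length bs = i \<and> set bs \<subseteq> {1, 0, -1} \<and> n = (\<Sum>j<i. bs ! j * 2 ^ j)}"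

definition f :: "int \<Rightarrow> nat \<Rightarrow> nat" where
  "f n i = card (bsd_reps n i)"

end

(* Split the representations by their most significant digit. The digit -1 is impossible for
   n >= 0, since the remaining i - 1 digits represent only integers of absolute value below
   2^(i-1); the absolute value in the recurrence is harmless because negating all digits gives
   f (-n) i = f n i. *)
theory Submission imports Defs begin

lemma finite_bsd_reps: "finite (bsd_reps n i)"
proof (rule finite_subset)
  show "bsd_reps n i \<subseteq> {bs. set bs \<subseteq> {1, 0, -1} \<and> length bs = i}"
    by (auto simp: bsd_reps_def)
  show "finite {bs::int list. set bs \<subseteq> {1, 0, -1} \<and> length bs = i}"
    by (rule finite_lists_length_eq) simp
qed

lemma bsd_reps_0: "bsd_reps n 0 = (if n = 0 then {[]} else {})"
  by (auto simp: bsd_reps_def)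

text \<open>Digits are stored least significant first, so appending \<open>d\<close> to a list of
  length \<open>i\<close> adds a top digit of weight \<open>2 ^ i\<close>.\<close>

lemma snoc_mem_bsd_reps_Suc:
  "bs @ [d] \<in> bsd_reps n (Suc i) \<longleftrightarrow> d \<in> {1, 0, -1} \<and> bs \<in> bsd_reps (n - d * 2 ^ i) i"
  by (auto simp: bsd_reps_def nth_append algebra_simps)

lemma bsd_reps_Suc:
  "bsd_reps n (Suc i) = (\<Union>d\<in>{1, 0, -1}. (\<lambda>bs. bs @ [d]) ` bsd_reps (n - d * 2 ^ i) i)"
  (is "?L = ?R")
proof (rule set_eqI)
  fix cs
  show "cs \<in> ?L \<longleftrightarrow> cs \<in> ?R"
  proof (cases cs rule: rev_cases)
    case Nil
    then show ?thesis by (auto simp: bsd_reps_def)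
  next
    case (snoc bs d)
    then show ?thesis unfolding snoc snoc_mem_bsd_reps_Suc by blast
  qed
qed

lemma f_Suc: "f n (Suc i) = f (n - 2 ^ i) i + f n i + f (n + 2 ^ i) i"
proof -
  have "f n (Suc i) = (\<Sum>d\<in>{1, 0, -1}. card ((\<lambda>bs. bs @ [d]) ` bsd_reps (n - d * 2 ^ i) i))"
    unfolding f_def bsd_reps_Suc
    \<comment> \<open>The three images are disjoint because their lists end in different
      digits.\<close>
    by (rule card_UN_disjoint) (auto simp: finite_bsd_reps)
  also have "\<dots> = (\<Sum>d\<in>{1, 0, -1}. f (n - d * 2 ^ i) i)"
    by (simp add: f_def card_image inj_on_def)
  finally show ?thesis by simp
qed

lemma f_eq_0: "2 ^ i \<le> \<bar>n\<bar> \<Longrightarrow> f n i = 0"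
proof (induction i arbitrary: n)
  case 0
  then show ?case by (auto simp: f_def bsd_reps_0)
next
  case (Suc i)
  \<comment> \<open>Since \<open>n\<close> has absolute value at least \<open>2 * 2 ^ i\<close>, a
    shift by at most \<open>2 ^ i\<close> leaves at least \<open>2 ^ i\<close>.\<close>
  then have "2 ^ i \<le> \<bar>n - 2 ^ i\<bar>" "2 ^ i \<le> \<bar>n\<bar>" "2 ^ i \<le> \<bar>n + 2 ^ i\<bar>"
    by auto
  then show ?case by (simp add: f_Suc Suc.IH)
qed

text \<open>Negating the argument swaps the outer two terms of \<open>f_Suc\<close> and preserves
  the middle one, so induction replaces an explicit bijection of digit lists.\<close>

lemma f_minus: "f (- n) i = f n i"
proof (induction i arbitrary: n)
  case 0
  then show ?case by (simp add: f_def bsd_reps_0)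
next
  case (Suc i)
  have "f (- n - 2 ^ i) i = f (n + 2 ^ i) i" "f (- n + 2 ^ i) i = f (n - 2 ^ i) i"
    using Suc.IH[of "n + 2 ^ i"] Suc.IH[of "n - 2 ^ i"] by (simp_all add: algebra_simps)
  then show ?case by (simp add: f_Suc Suc.IH)
qed

lemma f_abs: "f \<bar>n\<bar> i = f n i"
  by (simp add: abs_if f_minus)

theorem theorem1:
  "(\<forall>(n::int) (i::nat). n \<ge> 0 \<longrightarrow> i \<ge> 1 \<longrightarrow>
      f n i = f \<bar>n - 2 ^ (i - 1)\<bar> (i - 1) + f n (i - 1))
   \<and> (\<forall>i::nat. f 0 i = 1)"
proof (intro conjI allI impI)
  fix n :: int and i :: nat
  assume "n \<ge> 0" and "i \<ge> 1"
  then obtain k where "i = Suc k" by (cases i) auto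
  with \<open>n \<ge> 0\<close> show "f n i = f \<bar>n - 2 ^ (i - 1)\<bar> (i - 1) + f n (i - 1)"
    \<comment> \<open>As \<open>n\<close> is non-negative, \<open>n + 2 ^ k\<close> is at least
      \<open>2 ^ k\<close>, so the term of \<open>f_Suc\<close> for the digit -1 vanishes by
      \<open>f_eq_0\<close>.\<close>
    by (simp add: f_Suc f_abs f_eq_0)
next
  fix i :: nat
  show "f 0 i = 1"
    \<comment> \<open>In the inductive step both outer terms sit exactly on the boundary
      \<open>2 ^ i\<close> of \<open>f_eq_0\<close>, so only the middle term survives; the last
      \<open>simp\<close> settles the base case.\<close>
    by (induction i) (simp_all add: f_Suc f_eq_0, simp add: f_def bsd_reps_0)
qed

end
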